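(* Let $A$ be a subset of $\mathbb{R}^+$. Then the following statements are equivalent. (i) $A$ is nonporous at $0$ or $0\notin\overline{A\setminus\{0\}}$, where $\overline{A\setminus\{0\}}$ is the closure of the set $A\setminus\{0\}$. (ii) Every sequence $(h_n)_{n\in\mathbb{N}}$ of positive real numbers with $\lim_{n\to\infty}h_n=0$ belongs to $UMP(A)$. (iii) The pair $\{A,C\}$ is coherently porous for each $C\subseteq\mathbb{R}^+$.
   Context: $\mathbb{R}^+=[0,\infty)$. For $E\subseteq\mathbb{R}^+$ and $h>0$, $\lambda(E,h)$ denotes the length of the largest open subinterval of $(0,h)$ that contains no point of $E$ (and $\lambda(E,h)=0$ if there is no such nonempty interval). The right upper porosity of $E$ at $0$ is $\overline{p}(E)=\limsup_{h\to 0^+}\frac{\lambda(E,h)}{h}$. The set $E$ is nonporous at $0$ if $\overline{p}(E)=0$. For $E\subseteq\mathbb{R}^+$, $UMP(E)$ is the set of all sequences $(h_n)_{n\in\mathbb{N}}$ of positive real numbers with $\lim_{n\to\infty}h_n=0$ and $\overline{p}(E)=\lim_{n\to\infty}\frac{\lambda(E,h_n)}{h_n}$. A pair $\{A,B\}$ of subsets of $\mathbb{R}^+$ is coherently porous if $UMP(A)\cap UMP(B)\neq\varnothing$. *)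

theory Defs
  imports "HOL-Analysis.Analysis"
begin

text \<open>
  The supremum below is a maximum for \<open>h \<ge> 0\<close> (lemma \<open>gap_length_attained\<close>).
  The degenerate case \<open>a = b\<close> contributes the value 0, which is the value prescribed when no
  nonempty open subinterval of \<open>(0, h)\<close> misses \<open>E\<close>.
\<close>
definition gap_length :: "real set \<Rightarrow> real \<Rightarrow> real" where
  "gap_length E h = Sup {b - a | a b. 0 \<le> a \<and> a \<le> b \<and> b \<le> h \<and> {a<..<b} \<inter> E = {}}"

definition right_upper_porosity :: "real set \<Rightarrow> ereal" where
  "right_upper_porosity E = Limsup (at_right 0) (\<lambda>h. ereal (gap_length E h / h))"

definition nonporous_at_0 :: "real set \<Rightarrow> bool" where
  "nonporous_at_0 E \<longleftrightarrow> right_upper_porosity E = 0"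

definition UMP :: "real set \<Rightarrow> (nat \<Rightarrow> real) set" where
  "UMP E = {h. (\<forall>n. h n > 0) \<and> h \<longlonglongrightarrow> 0 \<and>
     (\<lambda>n. ereal (gap_length E (h n) / h n)) \<longlonglongrightarrow> right_upper_porosity E}"

definition coherently_porous :: "real set \<Rightarrow> real set \<Rightarrow> bool" where
  "coherently_porous A B \<longleftrightarrow> UMP A \<inter> UMP B \<noteq> {}"

lemma gap_length_attained:
  assumes "h \<ge> 0"
  shows "\<exists>a b. 0 \<le> a \<and> a \<le> b \<and> b \<le> h \<and> {a<..<b} \<inter> E = {} \<and> gap_length E h = b - a"
proof -
  define T where "T = {(a, b). 0 \<le> a \<and> a \<le> b \<and> b \<le> h \<and> {a<..<b} \<inter> E = {}}"
  have T_eq: "T = ({0..h} \<times> {0..h}) \<inter> {p. fst p \<le> snd p}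
      \<inter> (\<Inter>x\<in>E. {p. x \<le> fst p} \<union> {p. snd p \<le> x})"
  proof (rule set_eqI)
    fix p :: "real \<times> real"
    have "({fst p<..<snd p} \<inter> E = {}) \<longleftrightarrow> (\<forall>x\<in>E. x \<le> fst p \<or> snd p \<le> x)"
      by (auto simp: disjoint_iff) (meson not_le)
    then show "p \<in> T \<longleftrightarrow> p \<in> ({0..h} \<times> {0..h}) \<inter> {p. fst p \<le> snd p}
      \<inter> (\<Inter>x\<in>E. {p. x \<le> fst p} \<union> {p. snd p \<le> x})"
      by (cases p) (auto simp: T_def)
  qed
  have "compact T"
    unfolding T_eq
    by (intro compact_Int_closed compact_Times compact_Icc closed_INT ballI closed_Un
        closed_Collect_le continuous_intros)
  moreover have "(0, 0) \<in> T" using assms by (auto simp: T_def)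
  moreover have "continuous_on T (\<lambda>p. snd p - fst p)" by (intro continuous_intros)
  ultimately obtain p where p: "p \<in> T" "\<forall>q\<in>T. snd q - fst q \<le> snd p - fst p"
    using continuous_attains_sup[of T "\<lambda>p. snd p - fst p"] by blast
  obtain a b where ab: "p = (a, b)" by (cases p)
  have "gap_length E h = b - a"
    unfolding gap_length_def
  proof (rule cSup_eq_maximum)
    show "b - a \<in> {b - a | a b. 0 \<le> a \<and> a \<le> b \<and> b \<le> h \<and> {a<..<b} \<inter> E = {}}"
      using p(1) ab by (auto simp: T_def)
  next
    fix x assume "x \<in> {b - a | a b. 0 \<le> a \<and> a \<le> b \<and> b \<le> h \<and> {a<..<b} \<inter> E = {}}"
    then show "x \<le> b - a" using p(2) ab by (auto simp: T_def)
  qed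
  then show ?thesis using p(1) ab by (auto simp: T_def)
qed

end

theory Submission
  imports Defs
begin

text \<open>
  Write \<open>R\<^sub>E(h)\<close> for the relative gap length \<open>gap_length E h / h\<close> and \<open>p\<close> for the porosity of
  \<open>A\<close>. Everything rests on the gap length being monotone and 1-Lipschitz in \<open>h\<close>.

  If \<open>A\<close> is nonporous, then \<open>R\<^sub>A\<close> is nonnegative with upper limit 0, and if \<open>A\<close> has no positive
  points near 0, then \<open>R\<^sub>A\<close> is 1 near 0. In both cases \<open>R\<^sub>A\<close> converges to \<open>p\<close> at 0, so every
  null sequence realises the upper limit. Conversely, suppose that every null sequence does, and
  let \<open>a > 0\<close> be a point of \<open>A\<close> near 0. Moving the right end from \<open>a\<close> to \<open>a + gap_length A a\<close>
  creates no longer gap, because the point \<open>a\<close> separates the old part from the new one. Hence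
  \<open>R\<^sub>A\<close> drops from \<open>r\<close> to \<open>r / (1 + r)\<close>, and in the limit \<open>p = p / (1 + p)\<close>, which forces
  \<open>p = 0\<close> (lemma \<open>universal_UMP_imp_nonporous_or_isolated\<close>).

  As \<open>UMP C\<close> is never empty, coherence with every \<open>C\<close> follows if all null sequences lie in \<open>UMP A\<close>.
  Conversely, if they do not, then \<open>R\<^sub>A \<le> q\<close> holds at arbitrarily small scales for some \<open>q < p\<close>.
  For \<open>q'\<close> strictly between, let \<open>C\<close> consist of the \<open>x\<close> with \<open>R\<^sub>A(x) > q'\<close>. The gaps of \<open>C\<close> lie at
  scales at which \<open>A\<close> is far from its porosity. By monotonicity, below each bad scale \<open>y\<close> there is
  such a gap whose length is a fixed proportion of \<open>y\<close>, so \<open>C\<close> is porous. A scale \<open>h\<close> that nearly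
  attains the porosity of \<open>C\<close> must nearly be the right end of a gap of \<open>C\<close>, so by the Lipschitz
  bound \<open>R\<^sub>A(h)\<close> is at most about \<open>q'\<close>
  (lemma \<open>incoherent_partner\<close>).
\<close>

section \<open>Gap lengths\<close>

lemma gap_length_ge:
  assumes "0 \<le> a" "a \<le> b" "b \<le> h" "{a<..<b} \<inter> E = {}"
  shows "b - a \<le> gap_length E h"
  unfolding gap_length_def
proof (rule cSup_upper)
  show "bdd_above {b - a | a b. 0 \<le> a \<and> a \<le> b \<and> b \<le> h \<and> {a<..<b} \<inter> E = {}}"
    by (rule bdd_aboveI[of _ h]) auto
qed (use assms in blast)

lemma gap_length_nonneg: "h \<ge> 0 \<Longrightarrow> 0 \<le> gap_length E h"
  using gap_length_ge[of 0 0 h E] by simp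

lemma gap_length_le: "h \<ge> 0 \<Longrightarrow> gap_length E h \<le> h"
  using gap_length_attained[of h E] by auto

lemma gap_length_mono:
  assumes "0 \<le> h" "h \<le> k"
  shows "gap_length E h \<le> gap_length E k"
proof -
  obtain a b where "0 \<le> a" "a \<le> b" "b \<le> h" "{a<..<b} \<inter> E = {}" "gap_length E h = b - a"
    using gap_length_attained[OF assms(1)] by blast
  then show ?thesis using gap_length_ge[of a b k E] assms by simp
qed

text \<open>Cutting a gap of \<open>(0, k)\<close> at \<open>h\<close> loses at most \<open>k - h\<close>.\<close>

lemma gap_length_Lipschitz:
  assumes "0 \<le> h" "h \<le> k"
  shows "gap_length E k \<le> gap_length E h + (k - h)"
proof -
  obtain a b where ab: "0 \<le> a" "a \<le> b" "b \<le> k" "{a<..<b} \<inter> E = {}" "gap_length E k = b - a"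
    using gap_length_attained[of k E] assms by auto
  show ?thesis
  proof (cases "a \<le> h")
    case True
    have "{a<..<min b h} \<inter> E = {}" using ab(4) by auto
    then have "min b h - a \<le> gap_length E h"
      using gap_length_ge[of a "min b h" h E] ab True by auto
    then show ?thesis using ab assms by auto
  next
    case False
    then show ?thesis using ab gap_length_nonneg[OF assms(1), of E] by simp
  qed
qed

text \<open>The point \<open>a\<close> of \<open>E\<close> splits every gap of the longer interval: what lies to the right of \<open>a\<close>
  is no longer than the largest gap on the left.\<close>

lemma gap_length_past_point:
  assumes "a \<in> E" "0 \<le> a"
  shows "gap_length E (a + gap_length E a) = gap_length E a"
proof (rule antisym)
  let ?L = "gap_length E a"
  have L: "0 \<le> ?L" using gap_length_nonneg assms by simp
  obtain u v where uv: "0 \<le> u" "u \<le> v" "v \<le> a + ?L" "{u<..<v} \<inter> E = {}"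
      "gap_length E (a + ?L) = v - u"
    using gap_length_attained[of "a + ?L" E] assms L by auto
  have "v \<le> a \<or> a \<le> u" using uv(4) assms(1) by force
  then show "gap_length E (a + ?L) \<le> ?L"
    using gap_length_ge[OF uv(1,2) _ uv(4), of a] uv by auto
  show "?L \<le> gap_length E (a + ?L)" using gap_length_mono assms L by simp
qed

section \<open>The porosity as a real upper limit\<close>

lemma eventually_relative_gap_bounds:
  "\<forall>\<^sub>F h in at_right 0. 0 \<le> gap_length E h / h \<and> gap_length E h / h \<le> 1"
  unfolding eventually_at_right_field
  by (rule exI[of _ 1]) (auto simp: gap_length_nonneg gap_length_le)

lemma porosity_is_real:
  obtains p where "right_upper_porosity E = ereal p" "0 \<le> p" "p \<le> 1"
proof -
  have "right_upper_porosity E \<le> 1" unfolding right_upper_porosity_def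
    by (rule Limsup_bounded, rule eventually_mono[OF eventually_relative_gap_bounds[of E]]) simp
  moreover have "0 \<le> Liminf (at_right 0) (\<lambda>h. ereal (gap_length E h / h))"
    by (rule Liminf_bounded, rule eventually_mono[OF eventually_relative_gap_bounds[of E]]) simp
  then have "0 \<le> right_upper_porosity E" unfolding right_upper_porosity_def
    by (rule order_trans) (simp add: Liminf_le_Limsup)
  ultimately show ?thesis using that by (cases "right_upper_porosity E") auto
qed

lemma eventually_relative_gap_less:
  assumes "right_upper_porosity E = ereal p" "p < c"
  shows "\<forall>\<^sub>F h in at_right 0. gap_length E h / h < c"
proof -
  have "\<forall>\<^sub>F h in at_right 0. ereal (gap_length E h / h) < ereal c"
    by (rule Limsup_lessD) (use assms in \<open>simp add: right_upper_porosity_def\<close>)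
  then show ?thesis by simp
qed

lemma frequently_relative_gap_greater:
  assumes "right_upper_porosity E = ereal p" "c < p"
  shows "\<exists>\<^sub>F h in at_right 0. gap_length E h / h > c"
proof (rule ccontr)
  assume "\<not> (\<exists>\<^sub>F h in at_right 0. gap_length E h / h > c)"
  then have "\<forall>\<^sub>F h in at_right 0. ereal (gap_length E h / h) \<le> ereal c"
    by (simp add: not_frequently not_less)
  then have "right_upper_porosity E \<le> ereal c"
    unfolding right_upper_porosity_def by (rule Limsup_bounded)
  then show False using assms by simp
qed

lemma UMP_iff:
  assumes "right_upper_porosity E = ereal p"
  shows "h \<in> UMP E \<longleftrightarrow>
    (\<forall>n. h n > 0) \<and> h \<longlonglongrightarrow> 0 \<and> (\<lambda>n. gap_length E (h n) / h n) \<longlonglongrightarrow> p"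
  by (auto simp: UMP_def assms)

lemma null_sequence_at_right:
  fixes h :: "nat \<Rightarrow> real"
  assumes "\<And>n. h n > 0" "h \<longlonglongrightarrow> 0"
  shows "filterlim h (at_right 0) sequentially"
  using assms by (auto simp: filterlim_at less_imp_neq[symmetric])

text \<open>The upper limit is approached from above automatically, so convergence is a matter of lower
  bounds.\<close>

lemma null_sequence_in_UMP:
  assumes p: "right_upper_porosity E = ereal p"
    and low: "\<And>q. q < p \<Longrightarrow> \<forall>\<^sub>F x in at_right 0. q < gap_length E x / x"
    and h: "\<And>n. h n > 0" "h \<longlonglongrightarrow> 0"
  shows "h \<in> UMP E"
proof -
  have "((\<lambda>x. gap_length E x / x) \<longlongrightarrow> p) (at_right 0)"
    by (rule order_tendstoI[OF low eventually_relative_gap_less[OF p]])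
  then have "(\<lambda>n. gap_length E (h n) / h n) \<longlonglongrightarrow> p"
    by (rule filterlim_compose[OF _ null_sequence_at_right[OF h]])
  then show ?thesis using UMP_iff[OF p] h by simp
qed

lemma UMP_nonempty: "UMP E \<noteq> {}"
proof -
  obtain p where p: "right_upper_porosity E = ereal p" by (rule porosity_is_real)
  have "\<exists>h. 0 < h \<and> h < e \<and> \<bar>gap_length E h / h - p\<bar> < e" if "e > 0" for e
  proof -
    have "\<forall>\<^sub>F h in at_right 0. 0 < h \<and> h < e \<and> gap_length E h / h < p + e"
      using eventually_at_right_less[of 0] eventually_at_right_real[OF that]
        eventually_relative_gap_less[OF p, of "p + e"] that
      by (auto elim: eventually_elim2)
    then have "\<exists>\<^sub>F h in at_right 0. gap_length E h / h > p - e \<and>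
        0 < h \<and> h < e \<and> gap_length E h / h < p + e"
      using frequently_eventually_frequently[OF frequently_relative_gap_greater[OF p, of "p - e"]] that
      by simp
    from frequently_ex[OF this] show ?thesis by (auto simp: abs_less_iff)
  qed
  then have "\<forall>n. \<exists>h. 0 < h \<and> h < inverse (real (Suc n)) \<and>
      \<bar>gap_length E h / h - p\<bar> < inverse (real (Suc n))" by simp
  then obtain h where h: "\<And>n. 0 < h n" "\<And>n. h n < inverse (real (Suc n))"
      "\<And>n. \<bar>gap_length E (h n) / h n - p\<bar> < inverse (real (Suc n))" by metis
  have "h \<longlonglongrightarrow> 0"
    by (rule Lim_null_comparison[OF _ LIMSEQ_inverse_real_of_nat])
      (use h in \<open>auto intro!: always_eventually simp: less_imp_le\<close>)
  moreover have "(\<lambda>n. gap_length E (h n) / h n - p) \<longlonglongrightarrow> 0"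
    by (rule Lim_null_comparison[OF _ LIMSEQ_inverse_real_of_nat])
      (use h in \<open>auto intro!: always_eventually simp: less_imp_le\<close>)
  ultimately have "h \<in> UMP E" using UMP_iff[OF p] h(1) by (simp add: LIM_zero_iff)
  then show ?thesis by blast
qed

section \<open>Sets for which every scale is equally good\<close>

lemma nonporous_null_sequence_in_UMP:
  assumes "nonporous_at_0 A" "\<And>n. h n > 0" "h \<longlonglongrightarrow> 0"
  shows "h \<in> UMP A"
proof (rule null_sequence_in_UMP[where p = 0])
  show "right_upper_porosity A = ereal 0" using assms(1) by (simp add: nonporous_at_0_def)
  show "\<forall>\<^sub>F x in at_right 0. q < gap_length A x / x" if "q < 0" for q
    using eventually_relative_gap_bounds[of A] by eventually_elim (use that in simp)
qed (use assms in auto)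

lemma isolated_null_sequence_in_UMP:
  assumes "0 \<notin> closure (A - {0})" "\<And>n. h n > 0" "h \<longlonglongrightarrow> 0"
  shows "h \<in> UMP A"
proof -
  obtain e where e: "e > 0" "\<And>x. x \<in> A \<Longrightarrow> 0 < x \<Longrightarrow> e \<le> x"
    using assms(1) by (force simp: closure_approachable dist_real_def)
  have "gap_length A x = x" if "0 < x" "x < e" for x
  proof (rule antisym)
    have "{0<..<x} \<inter> A = {}" using e(2) that by force
    then show "x \<le> gap_length A x" using gap_length_ge[of 0 x x A] that by simp
  qed (use gap_length_le that in simp)
  then have ev: "\<forall>\<^sub>F x in at_right 0. gap_length A x / x = 1"
    unfolding eventually_at_right_field using e(1) by (intro exI[of _ e]) auto
  obtain p where p: "right_upper_porosity A = ereal p" "p \<le> 1" by (rule porosity_is_real)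
  show ?thesis
  proof (rule null_sequence_in_UMP[OF p(1) _ assms(2,3)])
    show "\<forall>\<^sub>F x in at_right 0. q < gap_length A x / x" if "q < p" for q
      using ev by eventually_elim (use that p in simp)
  qed
qed

lemma universal_UMP_imp_nonporous_or_isolated:
  assumes A: "A \<subseteq> {0..}"
    and all: "\<And>h. (\<And>n. h n > 0) \<Longrightarrow> h \<longlonglongrightarrow> 0 \<Longrightarrow> h \<in> UMP A"
  shows "nonporous_at_0 A \<or> 0 \<notin> closure (A - {0})"
proof (rule disjCI)
  assume "\<not> 0 \<notin> closure (A - {0})"
  then obtain a where a: "\<And>n. a n \<in> A - {0}" "a \<longlonglongrightarrow> 0"
    unfolding closure_sequential by blast
  have pos: "a n > 0" for n using a(1)[of n] A by force
  obtain p where p: "right_upper_porosity A = ereal p" "0 \<le> p" by (rule porosity_is_real)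
  let ?r = "\<lambda>n. gap_length A (a n) / a n"
  let ?b = "\<lambda>n. a n + gap_length A (a n)"
  have gap: "0 \<le> gap_length A (a n)" "gap_length A (a n) \<le> a n" for n
    using gap_length_nonneg gap_length_le pos[of n] by simp_all
  have "(\<lambda>n. gap_length A (a n)) \<longlonglongrightarrow> 0"
    by (rule Lim_null_comparison[OF _ a(2)]) (use gap in simp)
  then have "?b \<longlonglongrightarrow> 0" using tendsto_add[OF a(2)] by force
  moreover have "?b n > 0" for n using pos[of n] gap[of n] by simp
  ultimately have "(\<lambda>n. gap_length A (?b n) / ?b n) \<longlonglongrightarrow> p"
    using all[of ?b] UMP_iff[OF p(1)] by simp
  moreover have "gap_length A (?b n) / ?b n = ?r n / (1 + ?r n)" for n
    using gap_length_past_point[of "a n" A] a(1)[of n] pos[of n]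
    by (simp add: divide_simps)
  ultimately have "(\<lambda>n. ?r n / (1 + ?r n)) \<longlonglongrightarrow> p" by simp
  moreover have "?r \<longlonglongrightarrow> p" using all[of a] UMP_iff[OF p(1)] pos a(2) by simp
  then have "(\<lambda>n. ?r n / (1 + ?r n)) \<longlonglongrightarrow> p / (1 + p)"
    using p(2) by (intro tendsto_intros) auto
  ultimately have "p = p / (1 + p)" by (rule LIMSEQ_unique)
  then have "p = 0" using p(2) by (simp add: divide_simps)
  then show "nonporous_at_0 A" using p(1) by (simp add: nonporous_at_0_def)
qed

section \<open>An incoherent partner\<close>

text \<open>The partner is the set of scales at which the relative gap length of \<open>A\<close> exceeds a level
  \<open>q'\<close> between \<open>q\<close> and the porosity \<open>p\<close>: its gaps sit exactly where \<open>A\<close> is far from attaining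
  its upper limit. If the relative gap length of \<open>C\<close> at a small \<open>h\<close> is close to its upper limit
  \<open>P > 0\<close>, witnessed by a gap \<open>(u, v)\<close>, then \<open>h\<close> is close to \<open>v\<close>: otherwise \<open>(v - u) / v\<close>
  would exceed \<open>P\<close> noticeably.\<close>

lemma incoherent_partner:
  assumes p: "right_upper_porosity A = ereal p" "p \<le> 1"
    and "q < p" and low: "\<exists>\<^sub>F y in at_right 0. gap_length A y / y \<le> q"
  obtains C where "C \<subseteq> {0..}" "\<not> coherently_porous A C"
proof -
  have "\<exists>\<^sub>F y in at_right 0. gap_length A y / y \<le> q \<and>
      (0 \<le> gap_length A y / y \<and> gap_length A y / y \<le> 1)"
    by (rule frequently_eventually_frequently[OF low eventually_relative_gap_bounds])
  then have "0 \<le> q" by (rule frequently_ex[THEN exE]) linarith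
  define q' where "q' = (q + p) / 2"
  define p' where "p' = (q' + p) / 2"
  have q': "q < q'" "q' < p'" "p' < p" using \<open>q < p\<close> by (simp_all add: q'_def p'_def)
  define C where "C = {x. 0 \<le> x \<and> q' * x < gap_length A x}"
  obtain P where P: "right_upper_porosity C = ereal P" by (rule porosity_is_real)
  define d where "d = 1 - q / q'"
  have d: "d > 0" using \<open>0 \<le> q\<close> q' by (simp add: d_def)

  \<comment> \<open>Monotonicity turns a bad scale \<open>y\<close> of \<open>A\<close> into a gap of \<open>C\<close> of length \<open>d * y\<close> ending at \<open>y\<close>.\<close>
  have C_gap: "d \<le> gap_length C y / y" if y: "0 < y" "gap_length A y / y \<le> q" for y
  proof -
    have "x \<notin> C" if x: "q / q' * y < x" "x < y" for x
    proof -
      have "0 \<le> q / q' * y" using \<open>0 \<le> q\<close> q' y by simp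
      then have "0 \<le> x" using x by linarith
      have "gap_length A x \<le> gap_length A y" using gap_length_mono \<open>0 \<le> x\<close> x by simp
      also have "\<dots> \<le> q * y" using y by (simp add: divide_simps)
      also have "\<dots> \<le> q' * x" using x \<open>0 \<le> q\<close> q' by (simp add: field_simps)
      finally show ?thesis by (simp add: C_def)
    qed
    then have "{q / q' * y<..<y} \<inter> C = {}" by auto
    moreover have "q / q' * y \<le> y" "0 \<le> q / q' * y"
      using \<open>0 \<le> q\<close> q' y by (simp_all add: divide_simps)
    ultimately have "y - q / q' * y \<le> gap_length C y" using gap_length_ge by blast
    then show ?thesis using y by (simp add: d_def field_simps)
  qed
  have "P > 0"
  proof (rule ccontr)
    assume "\<not> P > 0"
    then have "\<forall>\<^sub>F y in at_right 0. gap_length C y / y < d"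
      using eventually_relative_gap_less[OF P] d by simp
    then have "\<forall>\<^sub>F y in at_right 0. gap_length C y / y < d \<and> 0 < y"
      using eventually_at_right_less[of 0] by (rule eventually_conj)
    then have "\<exists>\<^sub>F y in at_right 0. gap_length A y / y \<le> q \<and> (gap_length C y / y < d \<and> 0 < y)"
      by (rule frequently_eventually_frequently[OF low])
    from frequently_ex[OF this] show False using C_gap by force
  qed

  \<comment> \<open>By Lipschitz continuity the bad bound persists at the right end of a gap of \<open>C\<close>.\<close>
  have gap_end: "gap_length A v \<le> q' * v" if uv: "0 \<le> u" "u < v" "{u<..<v} \<inter> C = {}" for u v
  proof -
    have "\<forall>\<^sub>F x in at_left v. u < x \<and> x < v"
      using eventually_at_left_real[OF uv(2)] by simp
    then have "\<forall>\<^sub>F x in at_left v. gap_length A v \<le> q' * x + (v - x)"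
    proof eventually_elim
      case (elim x)
      then have "gap_length A x \<le> q' * x" using uv by (force simp: C_def)
      then show ?case using gap_length_Lipschitz[of x v A] elim uv by simp
    qed
    moreover have "((\<lambda>x. q' * x + (v - x)) \<longlongrightarrow> q' * v + (v - v)) (at_left v)"
      by (intro tendsto_intros)
    ultimately show ?thesis
      using tendsto_lowerbound[of "\<lambda>x. q' * x + (v - x)" "q' * v + (v - v)" "at_left v"]
      by simp
  qed

  \<comment> \<open>The tolerance is chosen so that \<open>(1 - q') * (1 - t) / (1 + t) \<ge> 1 - p'\<close>.\<close>
  define t where "t = (p' - q') / 2"
  have t: "0 < t" "t < 1" using q' \<open>0 \<le> q\<close> p(2) by (simp_all add: t_def)
  have "h \<notin> UMP A" if hC: "h \<in> UMP C" for h
  proof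
    assume hA: "h \<in> UMP A"
    have h: "\<And>n. h n > 0" "h \<longlonglongrightarrow> 0" using hA UMP_iff[OF p(1)] by auto
    have "\<forall>\<^sub>F y in at_right 0. gap_length C y / y < P * (1 + t)"
      by (rule eventually_relative_gap_less[OF P]) (use \<open>P > 0\<close> t in simp)
    then obtain e where e: "e > 0"
        "\<And>y. 0 < y \<Longrightarrow> y < e \<Longrightarrow> gap_length C y / y < P * (1 + t)"
      unfolding eventually_at_right_field by auto
    have "\<forall>\<^sub>F n in sequentially. h n < e"
      by (rule order_tendstoD(2)[OF h(2) e(1)])
    moreover have "\<forall>\<^sub>F n in sequentially. p' < gap_length A (h n) / h n"
      by (rule order_tendstoD(1)) (use hA UMP_iff[OF p(1)] q' in auto)
    moreover have "\<forall>\<^sub>F n in sequentially. P * (1 - t) < gap_length C (h n) / h n"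
      by (rule order_tendstoD(1)[where y = P]) (use hC UMP_iff[OF P] \<open>P > 0\<close> t in auto)
    ultimately have "\<forall>\<^sub>F n in sequentially. False"
    proof eventually_elim
      case (elim n)
      let ?h = "h n"
      have hpos: "?h > 0" by (rule h)
      obtain u v where uv: "0 \<le> u" "u \<le> v" "v \<le> ?h" "{u<..<v} \<inter> C = {}"
          "gap_length C ?h = v - u"
        using gap_length_attained[of ?h C] hpos by auto
      have big: "P * (1 - t) * ?h < v - u" using elim(3) uv hpos by (simp add: field_simps)
      have "0 < P * (1 - t) * ?h" using \<open>P > 0\<close> t hpos by simp
      then have "u < v" using big by linarith
      then have "v > 0" using uv by simp
      have "v - u \<le> gap_length C v" using gap_length_ge uv by simp
      also have "\<dots> < P * (1 + t) * v"
        using e(2)[of v] \<open>v > 0\<close> uv elim(1) by (simp add: field_simps)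
      finally have "P * ((1 - t) * ?h) < P * ((1 + t) * v)" using big by (simp add: mult.assoc)
      then have near: "(1 - t) * ?h < (1 + t) * v" using \<open>P > 0\<close> by simp
      moreover have "t * v \<le> t * ?h" using uv t by (intro mult_left_mono) auto
      ultimately have "?h - v \<le> 2 * t * ?h" by (simp add: algebra_simps)
      then have "(1 - q') * (?h - v) \<le> 2 * t * ?h"
        using q' \<open>0 \<le> q\<close> uv mult_right_mono[of "1 - q'" 1 "?h - v"] by simp
      then have close: "q' * v + (?h - v) \<le> p' * ?h"
        unfolding t_def by (simp add: algebra_simps)
      have "gap_length A ?h \<le> gap_length A v + (?h - v)"
        using gap_length_Lipschitz \<open>v > 0\<close> uv by simp
      also have "\<dots> \<le> p' * ?h" using gap_end[OF uv(1) \<open>u < v\<close> uv(4)] close by simp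
      finally show False using elim(2) hpos by (simp add: field_simps)
    qed
    then show False by simp
  qed
  then have "\<not> coherently_porous A C" by (auto simp: coherently_porous_def)
  moreover have "C \<subseteq> {0..}" by (auto simp: C_def)
  ultimately show ?thesis using that by blast
qed

lemma coherent_with_all_imp_universal_UMP:
  assumes coh: "\<And>C. C \<subseteq> {0..} \<Longrightarrow> coherently_porous A C"
    and h: "\<And>n. h n > 0" "h \<longlonglongrightarrow> 0"
  shows "h \<in> UMP A"
proof -
  obtain p where p: "right_upper_porosity A = ereal p" "p \<le> 1" by (rule porosity_is_real)
  show ?thesis
  proof (rule null_sequence_in_UMP[OF p(1) _ h], rule ccontr)
    fix q assume "q < p" "\<not> (\<forall>\<^sub>F x in at_right 0. q < gap_length A x / x)"
    then have "\<exists>\<^sub>F x in at_right 0. gap_length A x / x \<le> q"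
      by (simp add: not_eventually not_less)
    from incoherent_partner[OF p \<open>q < p\<close> this] show False using coh by blast
  qed
qed

section \<open>The characterisation\<close>

theorem theorem2p7:
  fixes A :: "real set"
  assumes "A \<subseteq> {0..}"
  shows "((nonporous_at_0 A \<or> 0 \<notin> closure (A - {0})) \<longleftrightarrow>
            (\<forall>h :: nat \<Rightarrow> real. (\<forall>n. h n > 0) \<and> h \<longlonglongrightarrow> 0 \<longrightarrow> h \<in> UMP A)) \<and>
         ((\<forall>h :: nat \<Rightarrow> real. (\<forall>n. h n > 0) \<and> h \<longlonglongrightarrow> 0 \<longrightarrow> h \<in> UMP A) \<longleftrightarrow>
            (\<forall>C. C \<subseteq> {0..} \<longrightarrow> coherently_porous A C))"
proof (intro conjI iffI)
  assume "nonporous_at_0 A \<or> 0 \<notin> closure (A - {0})"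
  then show "\<forall>h. (\<forall>n. h n > 0) \<and> h \<longlonglongrightarrow> 0 \<longrightarrow> h \<in> UMP A"
    using nonporous_null_sequence_in_UMP isolated_null_sequence_in_UMP by blast
next
  assume "\<forall>h. (\<forall>n. h n > 0) \<and> h \<longlonglongrightarrow> 0 \<longrightarrow> h \<in> UMP A"
  then show "nonporous_at_0 A \<or> 0 \<notin> closure (A - {0})"
    using universal_UMP_imp_nonporous_or_isolated[OF assms] by blast
next
  assume all: "\<forall>h. (\<forall>n. h n > 0) \<and> h \<longlonglongrightarrow> 0 \<longrightarrow> h \<in> UMP A"
  have "UMP C \<subseteq> UMP A" for C using all by (auto simp: UMP_def[of C])
  then show "\<forall>C. C \<subseteq> {0..} \<longrightarrow> coherently_porous A C"
    using UMP_nonempty unfolding coherently_porous_def by blast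
next
  assume "\<forall>C. C \<subseteq> {0..} \<longrightarrow> coherently_porous A C"
  then show "\<forall>h. (\<forall>n. h n > 0) \<and> h \<longlonglongrightarrow> 0 \<longrightarrow> h \<in> UMP A"
    using coherent_with_all_imp_universal_UMP by blast
qed

end
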